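(* Let $k$ be any positive integer and let $\rho_1,\rho_2\in(-1,1)$. Then $\boldsymbol{\Sigma}_{\rho_2}^{[k,1]}$ is positive definite if and only if $$1+\rho_2(k-1)>0.$$ Similarly, $\boldsymbol{\Sigma}_{\rho_1,\rho_2}^{[k,1]}$ is positive definite if and only if $$k\rho_1^2-1<(k-1)\rho_2.$$
   Context: For a positive integer $k$, $\boldsymbol{\Sigma}_{\rho_2}^{[k,1]}$ is the $k\times k$ matrix with all diagonal entries equal to $1$ and all off-diagonal entries equal to $\rho_2$, and $\boldsymbol{\Sigma}_{\rho_1,\rho_2}^{[k,1]}$ is the $(k+1)\times(k+1)$ matrix $$\boldsymbol{\Sigma}_{\rho_1,\rho_2}^{[k,1]}=\begin{pmatrix}1&\rho_1\mathbf{1}_k^{\mathrm T}\\ \rho_1\mathbf{1}_k&\boldsymbol{\Sigma}_{\rho_2}^{[k,1]}\end{pmatrix},$$ where $\mathbf{1}_k$ is the column vector of ones of length $k$. *)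

theory Defs
  imports Complex_Main "Jordan_Normal_Form.Matrix"
begin

definition positive_definite :: "real mat \<Rightarrow> bool" where
  "positive_definite A \<longleftrightarrow>
     square_mat A \<and> transpose_mat A = A \<and>
     (\<forall>x \<in> carrier_vec (dim_row A). x \<noteq> 0\<^sub>v (dim_row A) \<longrightarrow> x \<bullet> (A *\<^sub>v x) > 0)"

definition ones_col :: "nat \<Rightarrow> real mat" where
  "ones_col k = mat k 1 (\<lambda>_. 1)"

definition equicorr_mat :: "nat \<Rightarrow> real \<Rightarrow> real mat" where
  "equicorr_mat k r2 = mat k k (\<lambda>(i, j). if i = j then 1 else r2)"

definition bordered_equicorr_mat :: "nat \<Rightarrow> real \<Rightarrow> real \<Rightarrow> real mat" where
  "bordered_equicorr_mat k r1 r2 =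
     four_block_mat
       (1\<^sub>m 1)             (r1 \<cdot>\<^sub>m transpose_mat (ones_col k))
       (r1 \<cdot>\<^sub>m ones_col k)  (equicorr_mat k r2)"

lemma equicorr_mat_carrier [simp]: "equicorr_mat k r2 \<in> carrier_mat k k"
  unfolding equicorr_mat_def by (rule mat_carrier)

lemma bordered_equicorr_mat_carrier [simp]:
  "bordered_equicorr_mat k r1 r2 \<in> carrier_mat (k + 1) (k + 1)"
  unfolding bordered_equicorr_mat_def
  using four_block_carrier_mat[OF one_carrier_mat equicorr_mat_carrier]
  by (metis add.commute)

lemma bordered_equicorr_mat_index:
  assumes "i < k + 1" "j < k + 1"
  shows "bordered_equicorr_mat k r1 r2 $$ (i, j) =
    (if i = j then 1 else if i = 0 \<or> j = 0 then r1 else r2)"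
  using assms unfolding bordered_equicorr_mat_def equicorr_mat_def ones_col_def
  by (cases i; cases j) simp_all

end

theory Submission
  imports Defs "HOL-Analysis.Convex"
begin

text \<open>
  Write S for the sum and Q for the sum of squares of the entries of a vector in \<open>k\<close> variables.
  The quadratic form of the first matrix is \<open>(1 - \<rho>\<^sub>2) Q + \<rho>\<^sub>2 S\<^sup>2\<close>; completing the square in
  the additional variable \<open>t\<close> turns that of the second into
  \<open>(t + \<rho>\<^sub>1 S)\<^sup>2 + (1 - \<rho>\<^sub>2) Q + (\<rho>\<^sub>2 - \<rho>\<^sub>1\<^sup>2) S\<^sup>2\<close>.
  Since \<open>S\<^sup>2 \<le> k Q\<close> with equality at the all-ones vector, a form \<open>a Q + c S\<^sup>2\<close> with
  \<open>a > 0\<close> is positive definite exactly when \<open>a + k c > 0\<close>.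
\<close>

text \<open>For \<open>c \<ge> 0\<close> the first term is positive and the second nonnegative. For
  \<open>c < 0\<close>, Cauchy-Schwarz bounds the form below by \<open>a + real (card I) * c\<close>
  times the sum of squares.\<close>

lemma sum_squares_plus_square_sum_pos:
  fixes f :: "'a \<Rightarrow> real"
  assumes "finite I" "a > 0" "a + real (card I) * c > 0" "\<exists>i\<in>I. f i \<noteq> 0"
  shows "a * (\<Sum>i\<in>I. (f i)\<^sup>2) + c * (\<Sum>i\<in>I. f i)\<^sup>2 > 0"
proof -
  let ?Q = "\<Sum>i\<in>I. (f i)\<^sup>2" and ?S = "\<Sum>i\<in>I. f i"
  have Q: "?Q > 0"
    using assms(1,4) by (metis sum_pos2 zero_le_power2 zero_less_power2)
  show ?thesis
  proof (cases "c \<ge> 0")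
    case True
    then show ?thesis
      using Q assms(2) by (simp add: add_pos_nonneg)
  next
    case False
    then have "c * (?Q * real (card I)) \<le> c * ?S\<^sup>2"
      by (intro mult_left_mono_neg sum_squared_le_sum_of_squares) auto
    moreover have "(a + real (card I) * c) * ?Q > 0"
      using Q assms(3) by simp
    ultimately show ?thesis
      by (simp add: algebra_simps)
  qed
qed

lemma positive_definite_iff:
  assumes "A \<in> carrier_mat n n" "transpose_mat A = A"
  shows "positive_definite A \<longleftrightarrow>
    (\<forall>x \<in> carrier_vec n. x \<noteq> 0\<^sub>v n \<longrightarrow> x \<bullet> (A *\<^sub>v x) > 0)"
  using assms unfolding positive_definite_def by auto

lemma transpose_equicorr_mat: "transpose_mat (equicorr_mat k r) = equicorr_mat k r"
  by (rule eq_matI) (auto simp: equicorr_mat_def)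

lemma transpose_bordered_equicorr_mat:
  "transpose_mat (bordered_equicorr_mat k r1 r2) = bordered_equicorr_mat k r1 r2"
proof -
  have "dim_row (bordered_equicorr_mat k r1 r2) = k + 1"
    "dim_col (bordered_equicorr_mat k r1 r2) = k + 1"
    using bordered_equicorr_mat_carrier[of k r1 r2] by auto
  then show ?thesis
    by (intro eq_matI) (auto simp: bordered_equicorr_mat_index)
qed

text \<open>Row \<open>i\<close> is the constant row \<open>r\<close> plus \<open>1 - r\<close>
  times the \<open>i\<close>-th unit row.\<close>

lemma equicorr_row_sum:
  fixes f :: "nat \<Rightarrow> real"
  assumes "i < k"
  shows "(\<Sum>j<k. (if i = j then 1 else r) * f j) = (1 - r) * f i + r * (\<Sum>j<k. f j)"
proof -
  have "(\<Sum>j<k. (if i = j then 1 else r) * f j)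
    = (\<Sum>j<k. (if i = j then (1 - r) * f j else 0) + r * f j)"
    by (rule sum.cong) (auto simp: algebra_simps)
  also have "\<dots> = (1 - r) * f i + r * (\<Sum>j<k. f j)"
    using assms by (simp add: sum.distrib sum_distrib_left)
  finally show ?thesis .
qed

text \<open>Stated for a function \<open>f\<close> rather than a vector, so that it also applies to
  the shifted entries \<open>x $ Suc i\<close> in the bordered case.\<close>

lemma equicorr_double_sum:
  fixes f :: "nat \<Rightarrow> real"
  shows "(\<Sum>i<k. f i * (\<Sum>j<k. (if i = j then 1 else r) * f j))
    = (1 - r) * (\<Sum>i<k. (f i)\<^sup>2) + r * (\<Sum>i<k. f i)\<^sup>2"
proof -
  have "(\<Sum>i<k. f i * (\<Sum>j<k. (if i = j then 1 else r) * f j))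
    = (\<Sum>i<k. (1 - r) * (f i)\<^sup>2 + f i * (r * (\<Sum>j<k. f j)))"
    by (rule sum.cong)
      (simp_all only: lessThan_iff equicorr_row_sum, simp add: algebra_simps power2_eq_square)
  also have "\<dots> = (1 - r) * (\<Sum>i<k. (f i)\<^sup>2) + (\<Sum>i<k. f i) * (r * (\<Sum>j<k. f j))"
    by (simp only: sum.distrib flip: sum_distrib_left sum_distrib_right)
  finally show ?thesis
    by (simp add: power2_eq_square)
qed

lemma scalar_prod_mult_mat_vec_sum:
  fixes A :: "'a :: semiring_0 mat"
  assumes "A \<in> carrier_mat m n" "x \<in> carrier_vec m" "y \<in> carrier_vec n"
  shows "x \<bullet> (A *\<^sub>v y) = (\<Sum>i<m. x $ i * (\<Sum>j<n. A $$ (i, j) * y $ j))"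
  using assms by (auto simp: scalar_prod_def mult_mat_vec_def atLeast0LessThan intro!: sum.cong)

lemma equicorr_mat_form:
  assumes "x \<in> carrier_vec k"
  shows "x \<bullet> (equicorr_mat k r *\<^sub>v x)
    = (1 - r) * (\<Sum>i<k. (x $ i)\<^sup>2) + r * (\<Sum>i<k. x $ i)\<^sup>2"
  unfolding scalar_prod_mult_mat_vec_sum[OF equicorr_mat_carrier assms assms]
    equicorr_double_sum[symmetric]
  by (simp add: equicorr_mat_def)

text \<open>Splitting off index 0, the border row and the border column each contribute
  \<open>r1 * x $ 0 * S\<close>. Completing the square absorbs both and costs
  \<open>r1\<^sup>2 * S\<^sup>2\<close>, which lowers the coefficient of \<open>S\<^sup>2\<close>
  from \<open>r2\<close>.\<close>

lemma bordered_equicorr_mat_form: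
  assumes "x \<in> carrier_vec (k + 1)"
  defines "S \<equiv> \<Sum>i<k. x $ Suc i"
  shows "x \<bullet> (bordered_equicorr_mat k r1 r2 *\<^sub>v x)
    = (x $ 0 + r1 * S)\<^sup>2 + ((1 - r2) * (\<Sum>i<k. (x $ Suc i)\<^sup>2) + (r2 - r1\<^sup>2) * S\<^sup>2)"
proof -
  let ?A = "bordered_equicorr_mat k r1 r2"
  have row0: "(\<Sum>j<k + 1. ?A $$ (0, j) * x $ j) = x $ 0 + r1 * S"
    by (simp add: bordered_equicorr_mat_index sum.lessThan_Suc_shift S_def sum_distrib_left
        del: sum.lessThan_Suc)
  have row: "(\<Sum>j<k + 1. ?A $$ (Suc i, j) * x $ j)
      = r1 * x $ 0 + (\<Sum>j<k. (if i = j then 1 else r2) * x $ Suc j)" if "i < k" for i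
    using that by (simp add: bordered_equicorr_mat_index sum.lessThan_Suc_shift
        del: sum.lessThan_Suc cong: if_cong)
  have "x \<bullet> (?A *\<^sub>v x) = (\<Sum>i<k + 1. x $ i * (\<Sum>j<k + 1. ?A $$ (i, j) * x $ j))"
    by (rule scalar_prod_mult_mat_vec_sum[OF bordered_equicorr_mat_carrier assms(1) assms(1)])
  also have "\<dots> = x $ 0 * (\<Sum>j<k + 1. ?A $$ (0, j) * x $ j)
      + (\<Sum>i<k. x $ Suc i * (\<Sum>j<k + 1. ?A $$ (Suc i, j) * x $ j))"
    by (simp only: Suc_eq_plus1[symmetric] sum.lessThan_Suc_shift)
  also have "\<dots> = x $ 0 * (x $ 0 + r1 * S) + (\<Sum>i<k. x $ Suc i *
      (r1 * x $ 0 + (\<Sum>j<k. (if i = j then 1 else r2) * x $ Suc j)))"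
    \<comment> \<open>\<open>row\<close> is conditional on \<open>i < k\<close>;
      \<open>sum.cong\<close> supplies this bound.\<close>
    unfolding row0 by (intro arg_cong2[where f = "(+)"] sum.cong refl) (simp only: row lessThan_iff)
  also have "\<dots> = x $ 0 * (x $ 0 + r1 * S) + (S * (r1 * x $ 0)
      + ((1 - r2) * (\<Sum>i<k. (x $ Suc i)\<^sup>2) + r2 * S\<^sup>2))"
    unfolding S_def equicorr_double_sum[symmetric]
    by (simp only: distrib_left sum.distrib sum_distrib_right)
  finally show ?thesis
    by (simp add: power2_eq_square algebra_simps)
qed

lemma positive_definite_equicorr_mat_iff:
  assumes "k > 0" "r < 1"
  shows "positive_definite (equicorr_mat k r) \<longleftrightarrow> (1 - r) + real k * r > 0"
proof -
  let ?A = "equicorr_mat k r"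
  note pd = positive_definite_iff[OF equicorr_mat_carrier transpose_equicorr_mat]
  show ?thesis
  proof
    assume "positive_definite ?A"
    moreover define x :: "real vec" where "x = vec k (\<lambda>_. 1)"
    moreover have x: "x \<in> carrier_vec k" by (simp add: x_def)
    moreover have "x \<noteq> 0\<^sub>v k"
      using assms(1) by (auto simp: x_def vec_eq_iff)
    ultimately have "x \<bullet> (?A *\<^sub>v x) > 0"
      by (simp add: pd)
    \<comment> \<open>At the all-ones vector both the sum and the sum of squares equal
      \<open>k\<close>, so a factor \<open>k\<close> comes out.\<close>
    also have "x \<bullet> (?A *\<^sub>v x) = real k * ((1 - r) + real k * r)"
      by (simp add: equicorr_mat_form[OF x]) (simp add: x_def power2_eq_square algebra_simps)
    finally show "(1 - r) + real k * r > 0"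
      by (simp add: zero_less_mult_iff)
  next
    assume *: "(1 - r) + real k * r > 0"
    show "positive_definite ?A"
      unfolding pd
    proof (intro ballI impI)
      fix x :: "real vec"
      assume x: "x \<in> carrier_vec k" and "x \<noteq> 0\<^sub>v k"
      then have "\<exists>i\<in>{..<k}. x $ i \<noteq> 0"
        by (auto simp: vec_eq_iff)
      then show "x \<bullet> (?A *\<^sub>v x) > 0"
        unfolding equicorr_mat_form[OF x]
        using * assms(2) by (intro sum_squares_plus_square_sum_pos) auto
    qed
  qed
qed

lemma positive_definite_bordered_equicorr_mat_iff:
  assumes "k > 0" "r2 < 1"
  shows "positive_definite (bordered_equicorr_mat k r1 r2)
    \<longleftrightarrow> (1 - r2) + real k * (r2 - r1\<^sup>2) > 0"
proof -
  let ?A = "bordered_equicorr_mat k r1 r2"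
  note pd = positive_definite_iff[OF bordered_equicorr_mat_carrier transpose_bordered_equicorr_mat]
  show ?thesis
  proof
    assume "positive_definite ?A"
    \<comment> \<open>The first entry makes the completed square vanish.\<close>
    moreover define x :: "real vec"
      where "x = vec (k + 1) (\<lambda>i. if i = 0 then - r1 * real k else 1)"
    moreover have x: "x \<in> carrier_vec (k + 1)" by (simp add: x_def)
    moreover have "x \<noteq> 0\<^sub>v (k + 1)"
      \<comment> \<open>Index 1 exists because \<open>k > 0\<close>, and its entry is 1; entry 0 may
        vanish, namely when \<open>r1 = 0\<close>.\<close>
      using assms(1) by (auto simp: x_def vec_eq_iff intro!: exI[of _ 1])
    ultimately have "x \<bullet> (?A *\<^sub>v x) > 0"
      by (simp add: pd)
    also have "x \<bullet> (?A *\<^sub>v x) = real k * ((1 - r2) + real k * (r2 - r1\<^sup>2))"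
      unfolding bordered_equicorr_mat_form[OF x]
      by (simp add: x_def power2_eq_square algebra_simps)
    finally show "(1 - r2) + real k * (r2 - r1\<^sup>2) > 0"
      by (simp add: zero_less_mult_iff)
  next
    assume *: "(1 - r2) + real k * (r2 - r1\<^sup>2) > 0"
    show "positive_definite ?A"
      unfolding pd
    proof (intro ballI impI)
      fix x :: "real vec"
      assume x: "x \<in> carrier_vec (k + 1)" and nz: "x \<noteq> 0\<^sub>v (k + 1)"
      show "x \<bullet> (?A *\<^sub>v x) > 0"
      proof (cases "\<exists>i\<in>{..<k}. x $ Suc i \<noteq> 0")
        case True
        show ?thesis
          unfolding bordered_equicorr_mat_form[OF x]
          using * assms(2) True
          by (intro add_nonneg_pos[OF zero_le_power2] sum_squares_plus_square_sum_pos) auto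
      next
        case False
        \<comment> \<open>With all later entries zero, the form reduces to
          \<open>(x $ 0)\<^sup>2\<close>.\<close>
        have "x $ 0 \<noteq> 0"
        proof
          assume "x $ 0 = 0"
          then have "x $ i = 0" if "i < k + 1" for i
            using that False by (cases i) auto
          then show False
            using nz x by (auto simp: vec_eq_iff)
        qed
        then show ?thesis
          unfolding bordered_equicorr_mat_form[OF x] using False by simp
      qed
    qed
  qed
qed

theorem theorem1:
  fixes k :: nat and \<rho>\<^sub>1 \<rho>\<^sub>2 :: real
  assumes "k > 0"
    and "\<rho>\<^sub>1 \<in> {-1<..<1}"
    and "\<rho>\<^sub>2 \<in> {-1<..<1}"
  shows "(positive_definite (equicorr_mat k \<rho>\<^sub>2) \<longleftrightarrow> 1 + \<rho>\<^sub>2 * (real k - 1) > 0) \<and>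
         (positive_definite (bordered_equicorr_mat k \<rho>\<^sub>1 \<rho>\<^sub>2) \<longleftrightarrow>
           real k * \<rho>\<^sub>1\<^sup>2 - 1 < (real k - 1) * \<rho>\<^sub>2)"
proof -
  have "\<rho>\<^sub>2 < 1"
    using assms(3) by simp
  from positive_definite_equicorr_mat_iff[OF assms(1) this]
    positive_definite_bordered_equicorr_mat_iff[OF assms(1) this]
  show ?thesis
    \<comment> \<open>Both stated inequalities are rearrangements of the criteria
      \<open>a + k c > 0\<close> with \<open>a = 1 - \<rho>\<^sub>2\<close>.\<close>
    by (auto simp: algebra_simps)
qed

end
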